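(* There exist partial orders whose geometrical dimension is finite and whose Debreu dimension is countably infinite. In particular, there exists such a partial order whose geometrical dimension is $2$.
   Context: For a partial order $(X,\preceq)$, $x\prec y$ means $x\preceq y$ and not $y\preceq x$. A multi-utility is a family $(u_i)_{i\in I}$ of functions $u_i:X\to\mathbb{R}$ with $x\preceq y$ iff $u_i(x)\le u_i(y)$ for all $i\in I$; the geometrical dimension is the smallest cardinality of an index set of a multi-utility. A realizer is a family $(\preceq_i)_{i\in I}$ of linear extensions of $\preceq$ (total partial orders with $x\preceq y\Rightarrow x\preceq_i y$) such that $x\preceq y$ iff $x\preceq_i y$ for all $i$; it is Debreu separable if each $\preceq_i$ is Debreu separable, i.e. there is a countable $D\subseteq X$ with: $x\prec_i y$ implies $x\preceq_i d\preceq_i y$ for some $d\in D$. The Debreu dimension is the smallest cardinality of an index set of a Debreu separable realizer. *)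

theory Defs
  imports Complex_Main "HOL-Library.Countable_Set"
begin

unbundle cardinal_syntax

definition multi_utility ::
  "'a set \<Rightarrow> 'a rel \<Rightarrow> 'i set \<Rightarrow> ('i \<Rightarrow> 'a \<Rightarrow> real) \<Rightarrow> bool" where
  "multi_utility X r I u \<longleftrightarrow>
     (\<forall>x\<in>X. \<forall>y\<in>X. (x, y) \<in> r \<longleftrightarrow> (\<forall>i\<in>I. u i x \<le> u i y))"

definition linear_extension :: "'a set \<Rightarrow> 'a rel \<Rightarrow> 'a rel \<Rightarrow> bool" where
  "linear_extension X r l \<longleftrightarrow> linear_order_on X l \<and> r \<subseteq> l"

definition realizer ::
  "'a set \<Rightarrow> 'a rel \<Rightarrow> 'i set \<Rightarrow> ('i \<Rightarrow> 'a rel) \<Rightarrow> bool" where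
  "realizer X r I L \<longleftrightarrow>
     (\<forall>i\<in>I. linear_extension X r (L i)) \<and>
     (\<forall>x\<in>X. \<forall>y\<in>X. (x, y) \<in> r \<longleftrightarrow> (\<forall>i\<in>I. (x, y) \<in> L i))"

definition debreu_separable :: "'a set \<Rightarrow> 'a rel \<Rightarrow> bool" where
  "debreu_separable X l \<longleftrightarrow>
     (\<exists>D\<subseteq>X. countable D \<and>
        (\<forall>x\<in>X. \<forall>y\<in>X. (x, y) \<in> l \<and> (y, x) \<notin> l \<longrightarrow>
           (\<exists>d\<in>D. (x, d) \<in> l \<and> (d, y) \<in> l)))"

definition debreu_separable_realizer ::
  "'a set \<Rightarrow> 'a rel \<Rightarrow> 'i set \<Rightarrow> ('i \<Rightarrow> 'a rel) \<Rightarrow> bool" where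
  "debreu_separable_realizer X r I L \<longleftrightarrow>
     realizer X r I L \<and> (\<forall>i\<in>I. debreu_separable X (L i))"

text \<open>
  The two dimensions are given as relations to a cardinal \<open>\<kappa>\<close>, because a Debreu separable
  realizer need not exist. HOL cannot quantify over index sets of all types inside a definition.
  The index sets below have the type of the indexed objects, and this loses no generality: a
  family can be re-indexed by its own image, which is no larger than its index set. The lemmas
  that follow the definitions make this precise.
\<close>

definition has_geometrical_dimension :: "'a set \<Rightarrow> 'a rel \<Rightarrow> 'k rel \<Rightarrow> bool" where
  "has_geometrical_dimension X r \<kappa> \<longleftrightarrow>
     (\<exists>(I :: ('a \<Rightarrow> real) set) u. multi_utility X r I u \<and> |I| =o \<kappa>) \<and>
     (\<forall>(J :: ('a \<Rightarrow> real) set) v. multi_utility X r J v \<longrightarrow> \<kappa> \<le>o |J| )"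

definition has_debreu_dimension :: "'a set \<Rightarrow> 'a rel \<Rightarrow> 'k rel \<Rightarrow> bool" where
  "has_debreu_dimension X r \<kappa> \<longleftrightarrow>
     (\<exists>(I :: 'a rel set) L. debreu_separable_realizer X r I L \<and> |I| =o \<kappa>) \<and>
     (\<forall>(J :: 'a rel set) L. debreu_separable_realizer X r J L \<longrightarrow> \<kappa> \<le>o |J| )"

lemma multi_utility_image:
  "multi_utility X r I u \<Longrightarrow> multi_utility X r (u ` I) (\<lambda>f. f)"
  by (simp add: multi_utility_def)

lemma debreu_separable_realizer_image:
  "debreu_separable_realizer X r I L \<Longrightarrow> debreu_separable_realizer X r (L ` I) (\<lambda>l. l)"
  by (simp add: debreu_separable_realizer_def realizer_def)

lemma has_geometrical_dimension_le:
  fixes J :: "'j set"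
  assumes "has_geometrical_dimension X r \<kappa>" and "multi_utility X r J v"
  shows "\<kappa> \<le>o |J|"
proof -
  have "\<kappa> \<le>o |v ` J|"
    using assms(1) multi_utility_image[OF assms(2)] unfolding has_geometrical_dimension_def by blast
  then show ?thesis
    using card_of_image by (rule ordLeq_transitive)
qed

lemma has_debreu_dimension_le:
  fixes J :: "'j set"
  assumes "has_debreu_dimension X r \<kappa>" and "debreu_separable_realizer X r J L"
  shows "\<kappa> \<le>o |J|"
proof -
  have "\<kappa> \<le>o |L ` J|"
    using assms(1) debreu_separable_realizer_image[OF assms(2)] unfolding has_debreu_dimension_def by blast
  then show ?thesis
    using card_of_image by (rule ordLeq_transitive)
qed

lemma has_geometrical_dimensionI:
  fixes I :: "'i set"
  assumes "multi_utility X r I u" and "|I| =o \<kappa>"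
    and min: "\<And>(J :: ('a \<Rightarrow> real) set) v. multi_utility X r J v \<Longrightarrow> \<kappa> \<le>o |J|"
  shows "has_geometrical_dimension (X :: 'a set) r \<kappa>"
proof -
  have mu: "multi_utility X r (u ` I) (\<lambda>f. f)"
    using assms(1) by (rule multi_utility_image)
  have "|u ` I| \<le>o \<kappa>"
    using card_of_image assms(2) by (rule ordLeq_ordIso_trans)
  then have "|u ` I| =o \<kappa>"
    using min[OF mu] by (simp add: ordIso_iff_ordLeq)
  with mu min show ?thesis
    unfolding has_geometrical_dimension_def by blast
qed

lemma has_debreu_dimensionI:
  fixes I :: "'i set"
  assumes "debreu_separable_realizer X r I L" and "|I| =o \<kappa>"
    and min: "\<And>(J :: 'a rel set) L'. debreu_separable_realizer X r J L' \<Longrightarrow> \<kappa> \<le>o |J|"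
  shows "has_debreu_dimension (X :: 'a set) r \<kappa>"
proof -
  have re: "debreu_separable_realizer X r (L ` I) (\<lambda>l. l)"
    using assms(1) by (rule debreu_separable_realizer_image)
  have "|L ` I| \<le>o \<kappa>"
    using card_of_image assms(2) by (rule ordLeq_ordIso_trans)
  then have "|L ` I| =o \<kappa>"
    using min[OF re] by (simp add: ordIso_iff_ordLeq)
  with re min show ?thesis
    unfolding has_debreu_dimension_def by blast
qed

end

theory Submission
  imports Defs "HOL-Analysis.Continuum_Not_Denumerable" "HOL-Analysis.Finite_Cartesian_Product"
begin

text \<open>
  The witness consists of two antichains \<open>a\<^sub>x = (x, 0)\<close> and \<open>b\<^sub>x = (x, 1)\<close>, \<open>x \<in> [0, 1]\<close>, with
  \<open>a\<^sub>x \<preceq> b\<^sub>y\<close> iff \<open>x \<le> y\<close>. In a Debreu separable linear extension, some \<open>d\<close> of a countable set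
  lies between \<open>a\<^sub>x\<close> and \<open>b\<^sub>x\<close>. If \<open>x\<close> and \<open>y\<close> share such a \<open>d\<close> in every member of a realizer, then
  \<open>a\<^sub>x \<preceq> b\<^sub>y\<close> and \<open>a\<^sub>y \<preceq> b\<^sub>x\<close>, hence \<open>x = y\<close>. So a finite realizer would inject \<open>[0, 1]\<close>
  into a finite product of countable sets. Conversely, for each rational \<open>q\<close> cut both antichains at
  \<open>q\<close> and stack \<open>a\<^sub><\<^sub>q, b\<^sub><\<^sub>q, a\<^sub>\<ge>\<^sub>q, b\<^sub>\<ge>\<^sub>q\<close>, each ordered by increasing or by decreasing \<open>x\<close>; these
  countably many linear orders form a realizer.
\<close>

section \<open>Linear orders induced by injective real functions\<close>

definition induced_order :: "'a set \<Rightarrow> ('a \<Rightarrow> real) \<Rightarrow> 'a rel" where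
  "induced_order X g = {(x, y). x \<in> X \<and> y \<in> X \<and> g x \<le> g y}"

lemma linear_order_on_induced_order:
  assumes "inj_on g X"
  shows "linear_order_on X (induced_order X g)"
  using assms
  unfolding linear_order_on_def partial_order_on_def preorder_on_def induced_order_def
    refl_on_def trans_def antisym_def total_on_def inj_on_def
  by auto

text \<open>Distinct gaps of \<open>S\<close> are disjoint, so a rational chosen in each gap
  determines its left end.\<close>

lemma countable_left_gap_ends:
  fixes S :: "real set"
  shows "countable {x \<in> S. \<exists>y\<in>S. x < y \<and> S \<inter> {x<..<y} = {}}" (is "countable ?G")
proof -
  \<comment> \<open>This form of "q lies in the gap" does not mention the right end; for x < y in
    \<open>?G\<close> it yields f x < y < f y, hence injectivity.\<close>
  have "\<exists>q\<in>\<rat>. x < q \<and> (\<forall>z\<in>S. x < z \<longrightarrow> q < z)" if "x \<in> ?G" for x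
  proof -
    from that obtain y where y: "y \<in> S" "x < y" "S \<inter> {x<..<y} = {}" by blast
    obtain q where "q \<in> \<rat>" "x < q" "q < y"
      using Rats_dense_in_real[OF y(2)] by blast
    moreover have "y \<le> z" if "z \<in> S" "x < z" for z
      using y(3) that by (meson disjoint_iff greaterThanLessThan_iff not_le)
    ultimately show ?thesis by (meson less_le_trans)
  qed
  then have "\<forall>x\<in>?G. \<exists>q. q \<in> \<rat> \<and> x < q \<and> (\<forall>z\<in>S. x < z \<longrightarrow> q < z)"
    by blast
  from bchoice[OF this] obtain f where
    f: "\<And>x. x \<in> ?G \<Longrightarrow> f x \<in> \<rat> \<and> x < f x \<and> (\<forall>z\<in>S. x < z \<longrightarrow> f x < z)"
    by blast
  have "inj_on f ?G"
  proof (rule inj_onI)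
    fix x y assume xy: "x \<in> ?G" "y \<in> ?G" "f x = f y"
    show "x = y"
    proof (rule ccontr)
      assume "x \<noteq> y"
      then have "x < y \<or> y < x" by auto
      then show False
      proof
        assume "x < y"
        then have "f x < y" using f[OF xy(1)] xy(2) by blast
        then show False using f[OF xy(2)] xy(3) by simp
      next
        assume "y < x"
        then have "f y < x" using f[OF xy(2)] xy(1) by blast
        then show False using f[OF xy(1)] xy(3) by simp
      qed
    qed
  qed
  moreover have "f ` ?G \<subseteq> \<rat>" using f by blast
  ultimately show ?thesis
    by (meson countable_rat countable_image_inj_on countable_subset)
qed

lemma debreu_separable_induced_order:
  assumes "inj_on g X"
  shows "debreu_separable X (induced_order X g)"
proof -
  define h where "h = inv_into X g"
  define G where "G = {s \<in> g ` X. \<exists>t\<in>g ` X. s < t \<and> g ` X \<inter> {s<..<t} = {}}"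
  define P where "P = {(a, b). a \<in> \<rat> \<and> b \<in> \<rat> \<and> (\<exists>z\<in>X. a < g z \<and> g z < b)}"
  define c where "c = (\<lambda>(a, b). SOME z. z \<in> X \<and> a < g z \<and> g z < b)"
  have c: "c (a, b) \<in> X \<and> a < g (c (a, b)) \<and> g (c (a, b)) < b" if "(a, b) \<in> P" for a b
  proof -
    have "\<exists>z. z \<in> X \<and> a < g z \<and> g z < b" using that unfolding P_def by blast
    from someI_ex[OF this] show ?thesis unfolding c_def by simp
  qed
  have "P \<subseteq> \<rat> \<times> \<rat>" unfolding P_def by auto
  then have "countable P"
    using countable_SIGMA[OF countable_rat countable_rat] by (rule countable_subset)
  moreover have "countable G" unfolding G_def by (rule countable_left_gap_ends)
  ultimately have "countable (h ` G \<union> c ` P)" by simp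
  moreover have "h ` G \<union> c ` P \<subseteq> X"
    using c unfolding h_def G_def by (auto simp: inv_into_into)
  moreover have "\<exists>d\<in>h ` G \<union> c ` P. (x, d) \<in> induced_order X g \<and> (d, y) \<in> induced_order X g"
    if x: "x \<in> X" and y: "y \<in> X" and xy: "g x < g y" for x y
  proof (cases "g ` X \<inter> {g x<..<g y} = {}")
    case True
    then have "g x \<in> G" using x y xy unfolding G_def by blast
    moreover have "h (g x) = x" unfolding h_def using assms x by simp
    ultimately have "x \<in> h ` G" by force
    moreover have "(x, x) \<in> induced_order X g" "(x, y) \<in> induced_order X g"
      using x y xy unfolding induced_order_def by auto
    ultimately show ?thesis by blast
  next
    case False
    then obtain z where z: "z \<in> X" "g x < g z" "g z < g y" by auto
    obtain a where a: "a \<in> \<rat>" "g x < a" "a < g z" using Rats_dense_in_real[OF z(2)] by blast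
    obtain b where b: "b \<in> \<rat>" "g z < b" "b < g y" using Rats_dense_in_real[OF z(3)] by blast
    have ab: "(a, b) \<in> P" using z a b unfolding P_def by blast
    have "(x, c (a, b)) \<in> induced_order X g" "(c (a, b), y) \<in> induced_order X g"
      using c[OF ab] a b x y unfolding induced_order_def by auto
    then show ?thesis using ab by blast
  qed
  ultimately show ?thesis
    unfolding debreu_separable_def
    by (intro exI[of _ "h ` G \<union> c ` P"]) (auto simp: induced_order_def not_le)
qed

text \<open>Each failed comparison needs a utility that strictly reverses it, and one function
  cannot do both.\<close>

lemma two_le_card_multi_utility:
  assumes "multi_utility X r J v" "x \<in> X" "y \<in> X" "(x, y) \<notin> r" "(y, x) \<notin> r"
  shows "|{..<2 :: nat}| \<le>o |J|"
proof -
  obtain i j where ij: "i \<in> J" "j \<in> J" "v i y < v i x" "v j x < v j y"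
    using assms unfolding multi_utility_def by (meson not_le)
  then have "i \<noteq> j" by auto
  then have "inj_on (\<lambda>n. if n = 0 then i else j) {..<2 :: nat}"
    by (auto simp: inj_on_def split: if_splits)
  moreover have "(\<lambda>n. if n = 0 then i else j) ` {..<2 :: nat} \<subseteq> J"
    using ij by auto
  ultimately show ?thesis
    using card_of_ordLeq by blast
qed

section \<open>The ladder order and its geometrical dimension\<close>

definition ladder :: "(real \<times> real) set" where
  "ladder = {0..1} \<times> {0, 1}"

definition ladder_order :: "(real \<times> real) rel" where
  "ladder_order = {(p, q). p \<in> ladder \<and> q \<in> ladder \<and>
     (p = q \<or> snd p = 0 \<and> snd q = 1 \<and> fst p \<le> fst q)}"

lemma partial_order_on_ladder: "partial_order_on ladder ladder_order"
  unfolding partial_order_on_def preorder_on_def ladder_order_def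
    refl_on_def trans_def antisym_def
  by auto

text \<open>The two functions order each antichain oppositely. The summand \<open>2 * snd p\<close>
  lifts the second one on the upper level above all its values on the lower level, so between levels
  only \<open>fst\<close> decides upward comparisons and the second function refutes downward
  ones.\<close>

lemma multi_utility_ladder:
  "multi_utility ladder ladder_order {..<2 :: nat}
     (\<lambda>i p. if i = 0 then fst p else 2 * snd p - fst p)"
  unfolding multi_utility_def ladder_order_def ladder_def
  by (auto simp: lessThan_nat_numeral lessThan_Suc)

lemma has_geometrical_dimension_ladder:
  "has_geometrical_dimension ladder ladder_order |{..<2 :: nat}|"
proof (rule has_geometrical_dimensionI[OF multi_utility_ladder card_of_refl])
  fix J :: "(real \<times> real \<Rightarrow> real) set" and v
  assume "multi_utility ladder ladder_order J v"
  moreover have "(0, 0) \<in> ladder" "(1, 0) \<in> ladder"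
    "((0, 0), (1, 0)) \<notin> ladder_order" "((1, 0), (0, 0)) \<notin> ladder_order"
    unfolding ladder_def ladder_order_def by auto
  ultimately show "|{..<2 :: nat}| \<le>o |J|"
    by (rule two_le_card_multi_utility)
qed

section \<open>A countable Debreu separable realizer\<close>

text \<open>
  The cut at \<open>q\<close> gives four blocks of values around \<open>0, 3, 6, 9\<close>; adding \<open>\<plusminus>x\<close> with \<open>x \<in> [0, 1]\<close>
  keeps them apart.
\<close>

definition cut_utility :: "real \<times> real \<Rightarrow> real \<times> real \<Rightarrow> real" where
  "cut_utility = (\<lambda>(q, s) p. 3 * ((if q \<le> fst p then 2 else 0) + snd p) + s * fst p)"

lemma inj_on_cut_utility:
  assumes "s \<in> {1, -1}"
  shows "inj_on (cut_utility (q, s)) ladder"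
  using assms unfolding inj_on_def cut_utility_def ladder_def
  by (auto split: if_splits)

lemma realizer_ladder:
  "realizer ladder ladder_order (\<rat> \<times> {1, -1}) (\<lambda>i. induced_order ladder (cut_utility i))"
  unfolding realizer_def
proof (intro conjI ballI)
  fix i :: "real \<times> real" assume "i \<in> \<rat> \<times> {1, -1}"
  then obtain q s where i: "i = (q, s)" "s \<in> {1, -1}" by blast
  \<comment> \<open>For x \<le> y the cut never favours x, and the level offset 3 outweighs the
    change of at most 1 in the term with \<open>s\<close>.\<close>
  have "ladder_order \<subseteq> induced_order ladder (cut_utility i)"
    using i unfolding ladder_order_def induced_order_def cut_utility_def ladder_def
    by (auto split: if_splits)
  then show "linear_extension ladder ladder_order (induced_order ladder (cut_utility i))"
    unfolding linear_extension_def
    using linear_order_on_induced_order inj_on_cut_utility i by blast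
next
  fix p p' assume p: "p \<in> ladder" "p' \<in> ladder"
  show "(p, p') \<in> ladder_order \<longleftrightarrow>
      (\<forall>i\<in>\<rat> \<times> {1, -1}. (p, p') \<in> induced_order ladder (cut_utility i))" (is "_ \<longleftrightarrow> ?R")
  proof
    assume "(p, p') \<in> ladder_order"
    then show ?R
      unfolding ladder_order_def induced_order_def cut_utility_def ladder_def
      by (auto split: if_splits)
  next
    assume ?R
    then have R: "cut_utility (q, s) p \<le> cut_utility (q, s) p'" if "q \<in> \<rat>" "s \<in> {1, -1}" for q s
      using that unfolding induced_order_def by blast
    obtain x t where xt: "p = (x, t)" "0 \<le> x" "x \<le> 1" "t = 0 \<or> t = 1"
      using p unfolding ladder_def by auto
    obtain y w where yw: "p' = (y, w)" "0 \<le> y" "y \<le> 1" "w = 0 \<or> w = 1"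
      using p unfolding ladder_def by auto
    \<comment> \<open>The cut at 2 lies beyond [0, 1] and so leaves both antichains whole; adding
      the two inequalities gives \<open>t \<le> w\<close>.\<close>
    have uncut: "3 * t + x \<le> 3 * w + y" "3 * t - x \<le> 3 * w - y"
      using R[of 2 1] R[of 2 "-1"] xt yw unfolding cut_utility_def by auto
    then have "t \<le> w" using xt yw by auto
    show "(p, p') \<in> ladder_order"
    proof (cases "t = w")
      case True
      then show ?thesis using uncut xt(1) yw(1) p unfolding ladder_order_def by auto
    next
      case False
      then have tw: "t = 0" "w = 1" using \<open>t \<le> w\<close> xt yw by auto
      have "x \<le> y"
      proof (rule ccontr)
        assume "\<not> x \<le> y"
        \<comment> \<open>The cut at such a q puts the lower point at 6 + x, above the upper point
          at 3 + y.\<close>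
        then obtain q where q: "q \<in> \<rat>" "y < q" "q < x"
          using Rats_dense_in_real[of y x] by auto
        then show False
          using R[of q 1] xt yw tw unfolding cut_utility_def by auto
      qed
      then show ?thesis using tw xt(1) yw(1) p unfolding ladder_order_def by auto
    qed
  qed
qed

lemma debreu_separable_realizer_ladder:
  "debreu_separable_realizer ladder ladder_order (\<rat> \<times> {1, -1})
     (\<lambda>i. induced_order ladder (cut_utility i))"
  unfolding debreu_separable_realizer_def
  using realizer_ladder debreu_separable_induced_order inj_on_cut_utility by blast

section \<open>Lower bound for the Debreu dimension\<close>

lemma infinite_debreu_separable_realizer_ladder:
  assumes "debreu_separable_realizer ladder ladder_order J L"
  shows "infinite J"
proof
  assume fin: "finite J"
  have re: "realizer ladder ladder_order J L" and sep: "\<forall>i\<in>J. debreu_separable ladder (L i)"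
    using assms unfolding debreu_separable_realizer_def by auto
  have lin: "linear_order_on ladder (L i)" "ladder_order \<subseteq> L i" if "i \<in> J" for i
    using re that unfolding realizer_def linear_extension_def by auto
  have mem: "(x, 0) \<in> ladder" "(x, 1) \<in> ladder" if "x \<in> {0..1}" for x
    using that unfolding ladder_def by auto
  obtain D where D: "\<And>i. i \<in> J \<Longrightarrow> countable (D i)"
    and Dsep: "\<And>i x y. i \<in> J \<Longrightarrow> x \<in> ladder \<Longrightarrow> y \<in> ladder \<Longrightarrow> (x, y) \<in> L i \<Longrightarrow> (y, x) \<notin> L i \<Longrightarrow>
      \<exists>d\<in>D i. (x, d) \<in> L i \<and> (d, y) \<in> L i"
    using sep unfolding debreu_separable_def by metis
  have "\<exists>d\<in>D i. ((x, 0), d) \<in> L i \<and> (d, (x, 1)) \<in> L i" if i: "i \<in> J" and x: "x \<in> {0..1}" for i x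
  proof (rule Dsep[OF i mem[OF x]])
    show le: "((x, 0), (x, 1)) \<in> L i"
      using lin(2)[OF i] mem[OF x] unfolding ladder_order_def by auto
    \<comment> \<open>Separability speaks of strict pairs only; strictness holds because the two
      points differ in level.\<close>
    have "antisym (L i)"
      using lin(1)[OF i] unfolding linear_order_on_def partial_order_on_def by blast
    then show "((x, 1), (x, 0)) \<notin> L i"
      using le unfolding antisym_def by fastforce
  qed
  then obtain d where d: "\<And>i x. i \<in> J \<Longrightarrow> x \<in> {0..1} \<Longrightarrow>
      d i x \<in> D i \<and> ((x, 0), d i x) \<in> L i \<and> (d i x, (x, 1)) \<in> L i"
    by metis
  \<comment> \<open>\<open>restrict\<close> makes \<open>F x\<close> extensional, so that it lies in
    \<open>PiE J D\<close>.\<close>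
  define F where "F = (\<lambda>x. restrict (\<lambda>i. d i x) J)"
  have le: "x \<le> y" if x: "x \<in> {0..1}" and y: "y \<in> {0..1}" and eq: "F x = F y" for x y
  proof -
    have "((x, 0), (y, 1)) \<in> L i" if i: "i \<in> J" for i
    proof -
      have "d i x = d i y" using fun_cong[OF eq, of i] i unfolding F_def by simp
      moreover have "trans (L i)"
        using lin(1)[OF i] unfolding linear_order_on_def partial_order_on_def preorder_on_def by blast
      ultimately show ?thesis using d[OF i x] d[OF i y] by (metis transD)
    qed
    then have "((x, 0), (y, 1)) \<in> ladder_order"
      using re mem x y unfolding realizer_def by blast
    then show ?thesis unfolding ladder_order_def by auto
  qed
  have "inj_on F {0..1}"
    by (rule inj_onI, rule order_antisym) (rule le; simp)+
  moreover have "F ` {0..1} \<subseteq> PiE J D" using d unfolding F_def by auto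
  moreover have "countable (PiE J D)" using fin D by (rule countable_PiE)
  ultimately have "countable {0..1 :: real}"
    by (meson countable_image_inj_on countable_subset)
  then show False using uncountable_closed_interval[of 0 1] by simp
qed

lemma has_debreu_dimension_ladder:
  "has_debreu_dimension ladder ladder_order |UNIV :: nat set|"
proof (rule has_debreu_dimensionI[OF debreu_separable_realizer_ladder])
  have "countable (\<rat> \<times> {1, -1 :: real} :: (real \<times> real) set)"
    by (intro countable_SIGMA countable_rat) simp
  \<comment> \<open>The lower bound, applied to this realizer itself, shows that its index set is
    infinite.\<close>
  moreover have "infinite (\<rat> \<times> {1, -1 :: real} :: (real \<times> real) set)"
    using infinite_debreu_separable_realizer_ladder[OF debreu_separable_realizer_ladder] .
  ultimately obtain e :: "real \<times> real \<Rightarrow> nat" where "bij_betw e (\<rat> \<times> {1, -1}) UNIV"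
    by (rule countableE_infinite)
  then show "|\<rat> \<times> {1, -1 :: real} :: (real \<times> real) set| =o |UNIV :: nat set|"
    using card_of_ordIso by blast
next
  fix J :: "(real \<times> real) rel set" and L
  assume "debreu_separable_realizer ladder ladder_order J L"
  then show "|UNIV :: nat set| \<le>o |J|"
    using infinite_debreu_separable_realizer_ladder infinite_iff_card_of_nat by blast
qed

theorem theorem2:
  shows "(\<exists>(X :: (real \<times> real) set) r. partial_order_on X r \<and>
            (\<exists>n :: nat. has_geometrical_dimension X r |{..<n}| ) \<and>
            has_debreu_dimension X r |UNIV :: nat set| ) \<and>
         (\<exists>(X :: (real \<times> real) set) r. partial_order_on X r \<and>
            has_geometrical_dimension X r |{..<2 :: nat}| \<and>
            has_debreu_dimension X r |UNIV :: nat set| )"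
  using partial_order_on_ladder has_geometrical_dimension_ladder has_debreu_dimension_ladder
  by blast

end
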